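(* Fix integers $S,T,m,m_{\max}\ge1$, finite sets $\mathcal{F}\subset\mathbb{R}^S$ and $\mathcal{T}\subset\mathbb{R}^T$, and $\alpha,\beta\ge0$ with $\alpha+\beta\le1$. Then the loss $\mathrm{FNGW}_{\alpha,\beta}:\mathcal{G}_m\times\mathcal{G}\to\mathbb{R}$ admits an Implicit Loss Embedding: there exist a separable Hilbert space $\mathcal{H}$ and measurable bounded maps $\psi:\mathcal{G}_m\to\mathcal{H}$, $\varphi:\mathcal{G}\to\mathcal{H}$ such that $\mathrm{FNGW}_{\alpha,\beta}(z,y)=\langle\psi(z),\varphi(y)\rangle_{\mathcal{H}}$ for all $z\in\mathcal{G}_m$, $y\in\mathcal{G}$, and $\|\varphi(y)\|_{\mathcal{H}}\le1$ for all $y\in\mathcal{G}$.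
   Context: $\mathcal{G}$ is the set of labeled graphs $g=(F,A,E,\boldsymbol p)$ with $m_g\le m_{\max}$ nodes, $A\in\{0,1\}^{m_g\times m_g}$, $F=(F_i)_{i=1}^{m_g}\in\mathcal{F}^{m_g}$, $E=(E_{ij})\in\mathcal{T}^{m_g\times m_g}$, $\boldsymbol p=m_g^{-1}\mathbb{1}_{m_g}$ (a finite set). $\mathcal{G}_m$ is the set of $(F,A,E,\boldsymbol p)$ with $A\in[0,1]^{m\times m}$, $F\in\mathrm{Conv}(\mathcal{F})^m$, $E\in\mathrm{Conv}(\mathcal{T})^{m\times m}$, $\boldsymbol p=m^{-1}\mathbb{1}_m$, where $\mathrm{Conv}$ is the convex hull. For $g_m=(F,A,E,\boldsymbol p)\in\mathcal{G}_m$ and $g=(\tilde F,\tilde A,\tilde E,\tilde{\boldsymbol p})\in\mathcal{G}$, $$\mathrm{FNGW}_{\alpha,\beta}(g_m,g)=\min_{\pi\in\Pi(\boldsymbol p,\tilde{\boldsymbol p})}\sum_{i,j,k,l}\Big[\alpha\|E(i,k)-\tilde E(j,l)\|^2_{\mathbb{R}^T}+\beta|A(i,k)-\tilde A(j,l)|^2+(1-\alpha-\beta)\|F(i)-\tilde F(j)\|^2_{\mathbb{R}^S}\Big]\pi_{k,l}\pi_{i,j},$$ where $\Pi(\boldsymbol p,\tilde{\boldsymbol p})$ is the set of nonnegative matrices with row sums $\boldsymbol p$ and column sums $\tilde{\boldsymbol p}$. $\mathcal{G}_m$ carries the topology of $\mathbb{R}^{m\times S}\times\mathbb{R}^{m\times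 m}\times\mathbb{R}^{m\times m\times T}$ and $\mathcal{G}$ the discrete topology. *)

theory Defs
  imports "HOL-Analysis.Analysis"
begin

text \<open>Labeled graphs in the finite set G: a triple of node count n (with 1 \<le> n \<le> mmax),
  node features F, adjacency A, edge features E, indexed by naturals below n and
  set to zero outside (canonical representation). The weights p = 1/n are implicit.\<close>

type_synonym ('s, 't) lgraph =
  "nat \<times> (nat \<Rightarrow> real^'s) \<times> (nat \<Rightarrow> nat \<Rightarrow> real) \<times> (nat \<Rightarrow> nat \<Rightarrow> real^'t)"

definition graphs :: "(real^'s) set \<Rightarrow> (real^'t) set \<Rightarrow> nat \<Rightarrow> ('s, 't) lgraph set" where
  "graphs FF TT mmax = {(n, F, A, E).
      1 \<le> n \<and> n \<le> mmax \<and>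
      (\<forall>i<n. F i \<in> FF) \<and> (\<forall>i\<ge>n. F i = 0) \<and>
      (\<forall>i<n. \<forall>j<n. A i j \<in> {0, 1}) \<and> (\<forall>i j. (n \<le> i \<or> n \<le> j) \<longrightarrow> A i j = 0) \<and>
      (\<forall>i<n. \<forall>j<n. E i j \<in> TT) \<and> (\<forall>i j. (n \<le> i \<or> n \<le> j) \<longrightarrow> E i j = 0)}"

text \<open>Relaxed graphs G_m with m = CARD('m) nodes, living in the Euclidean space
  R^(m x S) x R^(m x m) x R^(m x m x T). The weights p = 1/m are implicit.\<close>

type_synonym ('s, 't, 'm) rgraph = "(real^'s^'m) \<times> (real^'m^'m) \<times> (real^'t^'m^'m)"

definition relaxed_graphs :: "(real^'s) set \<Rightarrow> (real^'t) set \<Rightarrow> ('s, 't, 'm::finite) rgraph set" where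
  "relaxed_graphs FF TT = {(F, A, E).
      (\<forall>i. F $ i \<in> convex hull FF) \<and>
      (\<forall>i k. A $ i $ k \<in> {0..1}) \<and>
      (\<forall>i k. E $ i $ k \<in> convex hull TT)}"

definition couplings :: "nat \<Rightarrow> ('m::finite \<Rightarrow> nat \<Rightarrow> real) set" where
  "couplings n = {\<pi>. (\<forall>i j. 0 \<le> \<pi> i j) \<and> (\<forall>i j. n \<le> j \<longrightarrow> \<pi> i j = 0) \<and>
      (\<forall>i. (\<Sum>j<n. \<pi> i j) = 1 / real CARD('m)) \<and>
      (\<forall>j<n. (\<Sum>i\<in>UNIV. \<pi> i j) = 1 / real n)}"

definition fngw_cost ::
  "real \<Rightarrow> real \<Rightarrow> ('s::finite, 't::finite, 'm::finite) rgraph \<Rightarrow> ('s, 't) lgraph \<Rightarrow> ('m \<Rightarrow> nat \<Rightarrow> real) \<Rightarrow> real" where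
  "fngw_cost \<alpha> \<beta> z y \<pi> = (case z of (F, A, E) \<Rightarrow> case y of (n, F', A', E') \<Rightarrow>
     (\<Sum>i\<in>UNIV. \<Sum>j<n. \<Sum>k\<in>UNIV. \<Sum>l<n.
        (\<alpha> * (norm (E $ i $ k - E' j l))\<^sup>2 + \<beta> * \<bar>A $ i $ k - A' j l\<bar>\<^sup>2
         + (1 - \<alpha> - \<beta>) * (norm (F $ i - F' j))\<^sup>2) * \<pi> k l * \<pi> i j))"

definition FNGW ::
  "real \<Rightarrow> real \<Rightarrow> ('s::finite, 't::finite, 'm::finite) rgraph \<Rightarrow> ('s, 't) lgraph \<Rightarrow> real" where
  "FNGW \<alpha> \<beta> z y = (INF \<pi>\<in>couplings (fst y). fngw_cost \<alpha> \<beta> z y \<pi>)"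

end

theory Submission
  imports Defs
begin

(* The set of labeled graphs is finite, so every loss on relaxed graphs times graphs is an inner
   product in R^N, N = |graphs|: take for phi y the indicator vector of y and for psi z the vector
   of values FNGW z y'. It remains to check that each coordinate FNGW(-, y') is Borel and bounded.
   It is an infimum over couplings of costs that are polynomial, hence continuous, in z; such an
   infimum is upper semicontinuous. It is bounded because the features range over convex hulls
   of finite sets and a coupling has total mass 1. *)

definition fngw_integrand ::
  "real \<Rightarrow> real \<Rightarrow> ('s::finite, 't::finite, 'm::finite) rgraph \<Rightarrow> ('s, 't) lgraph \<Rightarrow> 'm \<Rightarrow> nat \<Rightarrow> 'm \<Rightarrow> nat \<Rightarrow> real" where
  "fngw_integrand \<alpha> \<beta> z y i j k l = (case z of (F, A, E) \<Rightarrow> case y of (n, F', A', E') \<Rightarrow>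
     \<alpha> * (norm (E $ i $ k - E' j l))\<^sup>2 + \<beta> * \<bar>A $ i $ k - A' j l\<bar>\<^sup>2
     + (1 - \<alpha> - \<beta>) * (norm (F $ i - F' j))\<^sup>2)"

lemma fngw_cost_eq:
  "fngw_cost \<alpha> \<beta> z y \<pi> = (\<Sum>i\<in>UNIV. \<Sum>j<fst y. \<Sum>k\<in>UNIV. \<Sum>l<fst y.
     fngw_integrand \<alpha> \<beta> z y i j k l * \<pi> k l * \<pi> i j)"
  by (simp add: fngw_cost_def fngw_integrand_def split: prod.splits)

lemma fngw_integrand_nonneg:
  assumes "0 \<le> \<alpha>" "0 \<le> \<beta>" "\<alpha> + \<beta> \<le> 1"
  shows "0 \<le> fngw_integrand \<alpha> \<beta> z y i j k l"
  using assms by (simp add: fngw_integrand_def split: prod.splits)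

lemma continuous_on_fngw_integrand:
  "continuous_on UNIV (\<lambda>z. fngw_integrand \<alpha> \<beta> z y i j k l)"
  unfolding fngw_integrand_def case_prod_beta' by (intro continuous_intros)

lemma couplings_nonempty:
  assumes "1 \<le> n"
  shows "couplings n \<noteq> {}"
proof -
  have "(\<lambda>i j. if j < n then 1 / (real CARD('m) * real n) else 0) \<in> (couplings n :: ('m::finite \<Rightarrow> nat \<Rightarrow> real) set)"
    using assms unfolding couplings_def by auto
  then show ?thesis by blast
qed

lemma couplings_total_mass:
  assumes "\<pi> \<in> (couplings n :: ('m::finite \<Rightarrow> nat \<Rightarrow> real) set)"
  shows "(\<Sum>i\<in>UNIV. \<Sum>j<n. \<pi> i j) = 1"
  using assms by (simp add: couplings_def)

lemma fngw_cost_nonneg: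
  assumes "\<pi> \<in> couplings (fst y)" "0 \<le> \<alpha>" "0 \<le> \<beta>" "\<alpha> + \<beta> \<le> 1"
  shows "0 \<le> fngw_cost \<alpha> \<beta> z y \<pi>"
  using assms unfolding fngw_cost_eq couplings_def
  by (auto intro!: sum_nonneg mult_nonneg_nonneg fngw_integrand_nonneg)

lemma fngw_cost_le:
  assumes \<pi>: "\<pi> \<in> couplings (fst y)"
    and bound: "\<And>i j k l. j < fst y \<Longrightarrow> l < fst y \<Longrightarrow> fngw_integrand \<alpha> \<beta> z y i j k l \<le> K"
  shows "fngw_cost \<alpha> \<beta> z y \<pi> \<le> K"
proof -
  have \<pi>_nonneg: "0 \<le> \<pi> i j" for i j
    using \<pi> by (simp add: couplings_def)
  have "fngw_cost \<alpha> \<beta> z y \<pi> \<le> (\<Sum>i\<in>UNIV. \<Sum>j<fst y. \<Sum>k\<in>UNIV. \<Sum>l<fst y. K * \<pi> k l * \<pi> i j)"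
    unfolding fngw_cost_eq using bound \<pi>_nonneg by (intro sum_mono mult_right_mono) auto
  also have "\<dots> = K * (\<Sum>k\<in>UNIV. \<Sum>l<fst y. \<pi> k l) * (\<Sum>i\<in>UNIV. \<Sum>j<fst y. \<pi> i j)"
    by (simp add: sum_distrib_left sum_distrib_right)
  also have "\<dots> = K"
    using couplings_total_mass[OF \<pi>] by simp
  finally show ?thesis .
qed

lemma bdd_below_fngw_cost:
  assumes "0 \<le> \<alpha>" "0 \<le> \<beta>" "\<alpha> + \<beta> \<le> 1"
  shows "bdd_below ((\<lambda>\<pi>. fngw_cost \<alpha> \<beta> z y \<pi>) ` couplings (fst y))"
  using assms by (auto intro!: bdd_belowI2 fngw_cost_nonneg)

lemma FNGW_nonneg:
  assumes "1 \<le> fst y" "0 \<le> \<alpha>" "0 \<le> \<beta>" "\<alpha> + \<beta> \<le> 1"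
  shows "0 \<le> FNGW \<alpha> \<beta> z y"
  unfolding FNGW_def using assms
  by (intro cINF_greatest couplings_nonempty fngw_cost_nonneg)

lemma FNGW_le:
  fixes z :: "('s::finite, 't::finite, 'm::finite) rgraph"
  assumes "1 \<le> fst y" "0 \<le> \<alpha>" "0 \<le> \<beta>" "\<alpha> + \<beta> \<le> 1"
    and "\<And>i j k l. j < fst y \<Longrightarrow> l < fst y \<Longrightarrow> fngw_integrand \<alpha> \<beta> z y i j k l \<le> K"
  shows "FNGW \<alpha> \<beta> z y \<le> K"
proof -
  obtain \<pi> :: "'m \<Rightarrow> nat \<Rightarrow> real" where \<pi>: "\<pi> \<in> couplings (fst y)"
    using couplings_nonempty[OF assms(1)] by blast
  moreover have "fngw_cost \<alpha> \<beta> z y \<pi> \<le> K"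
    using \<pi> assms(5) by (rule fngw_cost_le)
  ultimately show ?thesis
    unfolding FNGW_def using assms(2-4) by (intro cINF_lower2 bdd_below_fngw_cost)
qed

lemma borel_measurable_INF_continuous:
  fixes f :: "'i \<Rightarrow> 'a::topological_space \<Rightarrow> real"
  assumes "I \<noteq> {}" "\<And>i. i \<in> I \<Longrightarrow> continuous_on UNIV (f i)"
    and "\<And>x. bdd_below ((\<lambda>i. f i x) ` I)"
  shows "(\<lambda>x. INF i\<in>I. f i x) \<in> borel_measurable borel"
  unfolding borel_measurable_iff_less
proof
  fix a
  have "{x \<in> space borel. (INF i\<in>I. f i x) < a} = (\<Union>i\<in>I. {x. f i x < a})"
    using cINF_less_iff[OF assms(1,3)] by auto
  also have "\<dots> \<in> sets borel"
    using assms(2) by (intro borel_open open_UN ballI open_Collect_less continuous_on_const) auto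
  finally show "{x \<in> space borel. (INF i\<in>I. f i x) < a} \<in> sets borel" .
qed

lemma continuous_on_fngw_cost:
  "continuous_on UNIV (\<lambda>z. fngw_cost \<alpha> \<beta> z y \<pi>)"
  unfolding fngw_cost_eq by (intro continuous_intros continuous_on_fngw_integrand)

lemma borel_measurable_FNGW:
  assumes "1 \<le> fst y" "0 \<le> \<alpha>" "0 \<le> \<beta>" "\<alpha> + \<beta> \<le> 1"
  shows "(\<lambda>z. FNGW \<alpha> \<beta> z y) \<in> borel_measurable borel"
  unfolding FNGW_def using assms
  by (intro borel_measurable_INF_continuous couplings_nonempty continuous_on_fngw_cost bdd_below_fngw_cost)

lemma fngw_integrand_bounded:
  fixes FF :: "(real^'s::finite) set" and TT :: "(real^'t::finite) set"
  assumes "finite FF" "finite TT" "0 \<le> \<alpha>" "0 \<le> \<beta>" "\<alpha> + \<beta> \<le> 1"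
  obtains K where "\<And>(z :: ('s, 't, 'm::finite) rgraph) y i j k l.
    z \<in> relaxed_graphs FF TT \<Longrightarrow> y \<in> graphs FF TT mmax \<Longrightarrow> j < fst y \<Longrightarrow> l < fst y \<Longrightarrow>
    fngw_integrand \<alpha> \<beta> z y i j k l \<le> K"
proof
  define dF where "dF = diameter (convex hull FF)"
  define dT where "dT = diameter (convex hull TT)"
  have dist_F: "norm (x - x') \<le> dF" if "x \<in> convex hull FF" "x' \<in> FF" for x x'
    using diameter_bounded_bound[OF bounded_convex_hull[OF finite_imp_bounded[OF assms(1)]]]
      that hull_inc[of x' FF] by (simp add: dF_def dist_norm)
  have dist_T: "norm (x - x') \<le> dT" if "x \<in> convex hull TT" "x' \<in> TT" for x x'
    using diameter_bounded_bound[OF bounded_convex_hull[OF finite_imp_bounded[OF assms(2)]]]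
      that hull_inc[of x' TT] by (simp add: dT_def dist_norm)
  fix z :: "('s, 't, 'm::finite) rgraph" and y i j k l
  assume z: "z \<in> relaxed_graphs FF TT" and y: "y \<in> graphs FF TT mmax"
    and jl: "j < fst y" "l < fst y"
  obtain F A E where z_eq: "z = (F, A, E)" by (cases z)
  obtain n F' A' E' where y_eq: "y = (n, F', A', E')" by (cases y)
  have "(norm (E $ i $ k - E' j l))\<^sup>2 \<le> dT\<^sup>2"
    using z y jl by (auto intro!: power_mono dist_T simp: z_eq y_eq relaxed_graphs_def graphs_def)
  moreover have "\<bar>A $ i $ k - A' j l\<bar>\<^sup>2 \<le> 1"
  proof -
    have "A $ i $ k \<in> {0..1}" "A' j l \<in> {0, 1}"
      using z y jl by (auto simp: z_eq y_eq relaxed_graphs_def graphs_def)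
    then show ?thesis by (auto simp: abs_square_le_1)
  qed
  moreover have "(norm (F $ i - F' j))\<^sup>2 \<le> dF\<^sup>2"
    using z y jl by (auto intro!: power_mono dist_F simp: z_eq y_eq relaxed_graphs_def graphs_def)
  ultimately have "fngw_integrand \<alpha> \<beta> z y i j k l \<le> 1 * dT\<^sup>2 + 1 * 1 + 1 * dF\<^sup>2"
    unfolding fngw_integrand_def z_eq y_eq prod.case using assms(3-5)
    by (intro add_mono mult_mono) auto
  then show "fngw_integrand \<alpha> \<beta> z y i j k l \<le> dT\<^sup>2 + 1 + dF\<^sup>2"
    by simp
qed

lemma finite_graphs:
  assumes "finite FF" "finite TT"
  shows "finite (graphs FF TT mmax)"
proof (rule finite_subset)
  let ?funs = "\<lambda>B d. {f. \<forall>x. (x \<in> {..<mmax} \<longrightarrow> f x \<in> B) \<and> (x \<notin> {..<mmax} \<longrightarrow> f x = d)}"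
  show "graphs FF TT mmax \<subseteq> {..mmax} \<times> ?funs (insert 0 FF) 0
      \<times> ?funs (?funs {0, 1} 0) (\<lambda>_. 0) \<times> ?funs (?funs (insert 0 TT) 0) (\<lambda>_. 0)"
    by (auto simp: graphs_def fun_eq_iff not_less) (metis le_trans not_le)+
  show "finite ({..mmax} \<times> ?funs (insert 0 FF) 0
      \<times> ?funs (?funs {0, 1} 0) (\<lambda>_. 0) \<times> ?funs (?funs (insert 0 TT) 0) (\<lambda>_. 0))"
    using assms by (intro finite_SigmaI finite_set_of_finite_funs) auto
qed

lemma finite_loss_embedding:
  fixes L :: "'z \<Rightarrow> 'y \<Rightarrow> real"
  assumes "finite Y"
    and measurable: "\<And>y. y \<in> Y \<Longrightarrow> (\<lambda>z. L z y) \<in> borel_measurable M"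
    and bounded: "\<And>z y. z \<in> Z \<Longrightarrow> y \<in> Y \<Longrightarrow> \<bar>L z y\<bar> \<le> K"
  obtains N :: nat and \<psi> :: "'z \<Rightarrow> nat \<Rightarrow> real" and \<phi> :: "'y \<Rightarrow> nat \<Rightarrow> real" where
    "\<And>z i. N \<le> i \<Longrightarrow> \<psi> z i = 0" "\<And>y i. N \<le> i \<Longrightarrow> \<phi> y i = 0"
    "\<And>i. i < N \<Longrightarrow> (\<lambda>z. \<psi> z i) \<in> borel_measurable M"
    "\<And>z. z \<in> Z \<Longrightarrow> (\<Sum>i<N. (\<psi> z i)\<^sup>2) \<le> real N * K\<^sup>2"
    "\<And>y. y \<in> Y \<Longrightarrow> (\<Sum>i<N. (\<phi> y i)\<^sup>2) = 1"
    "\<And>z y. y \<in> Y \<Longrightarrow> L z y = (\<Sum>i<N. \<psi> z i * \<phi> y i)"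
proof -
  obtain ys where ys: "set ys = Y" "distinct ys"
    using finite_distinct_list[OF assms(1)] by blast
  define N where "N = length ys"
  define \<psi> where "\<psi> z i = (if i < N then L z (ys ! i) else 0)" for z i
  define \<phi> where "\<phi> y i = (if i < N \<and> ys ! i = y then 1 else 0 :: real)" for y i
  have ys_in: "ys ! i \<in> Y" if "i < N" for i
    using that ys(1) by (auto simp: N_def)
  have \<phi>_delta: "\<exists>k<N. ys ! k = y \<and> \<phi> y = (\<lambda>i. if i = k then 1 else 0)" if y: "y \<in> Y" for y
  proof -
    obtain k where k: "k < N" "ys ! k = y"
      using y ys(1) by (auto simp: N_def in_set_conv_nth)
    then have "\<phi> y = (\<lambda>i. if i = k then 1 else 0)"
      using ys(2) by (auto simp: \<phi>_def N_def fun_eq_iff nth_eq_iff_index_eq)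
    with k show ?thesis by blast
  qed
  show ?thesis
  proof
    show "(\<lambda>z. \<psi> z i) \<in> borel_measurable M" if "i < N" for i
      using measurable[OF ys_in[OF that]] that by (simp add: \<psi>_def)
    show "(\<Sum>i<N. (\<psi> z i)\<^sup>2) \<le> real N * K\<^sup>2" if "z \<in> Z" for z
    proof -
      have "(\<psi> z i)\<^sup>2 \<le> K\<^sup>2" if "i < N" for i
        using bounded[OF \<open>z \<in> Z\<close> ys_in[OF that]] power_mono[of "\<bar>\<psi> z i\<bar>" K 2] that
        by (simp add: \<psi>_def)
      then show ?thesis
        using sum_bounded_above[of "{..<N}" "\<lambda>i. (\<psi> z i)\<^sup>2"] by simp
    qed
    show "(\<Sum>i<N. (\<phi> y i)\<^sup>2) = 1" if "y \<in> Y" for y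
      using \<phi>_delta[OF that] by (auto simp: if_distrib[of "\<lambda>x. x\<^sup>2"] cong: if_cong)
    show "L z y = (\<Sum>i<N. \<psi> z i * \<phi> y i)" if "y \<in> Y" for z y
      using \<phi>_delta[OF that] by (auto simp: \<psi>_def if_distrib[of "times _"] cong: if_cong)
  qed (simp_all add: \<psi>_def \<phi>_def)
qed

lemma graphs_nodes_ge_1: "y \<in> graphs FF TT mmax \<Longrightarrow> 1 \<le> fst y"
  by (auto simp: graphs_def)

lemma FNGW_bounded:
  fixes FF :: "(real^'s::finite) set" and TT :: "(real^'t::finite) set"
  assumes "finite FF" "finite TT" and weights: "0 \<le> \<alpha>" "0 \<le> \<beta>" "\<alpha> + \<beta> \<le> 1"
  obtains K where "\<And>(z :: ('s, 't, 'm::finite) rgraph) y.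
    z \<in> relaxed_graphs FF TT \<Longrightarrow> y \<in> graphs FF TT mmax \<Longrightarrow> \<bar>FNGW \<alpha> \<beta> z y\<bar> \<le> K"
proof -
  obtain K where K: "\<And>(z :: ('s, 't, 'm) rgraph) y i j k l.
      z \<in> relaxed_graphs FF TT \<Longrightarrow> y \<in> graphs FF TT mmax \<Longrightarrow> j < fst y \<Longrightarrow> l < fst y \<Longrightarrow>
      fngw_integrand \<alpha> \<beta> z y i j k l \<le> K"
    using fngw_integrand_bounded[OF assms] by blast
  have "\<bar>FNGW \<alpha> \<beta> z y\<bar> \<le> K"
    if "z \<in> relaxed_graphs FF TT" "y \<in> graphs FF TT mmax" for z :: "('s, 't, 'm) rgraph" and y
  proof -
    have "1 \<le> fst y" using that(2) by (rule graphs_nodes_ge_1)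
    then have "0 \<le> FNGW \<alpha> \<beta> z y" "FNGW \<alpha> \<beta> z y \<le> K"
      using FNGW_nonneg[OF _ weights] FNGW_le[OF _ weights K[OF that]] by blast+
    then show ?thesis by simp
  qed
  then show ?thesis using that by blast
qed

theorem proposition3p7:
  fixes FF :: "(real^'s::finite) set" and TT :: "(real^'t::finite) set"
    and mmax :: nat and \<alpha> \<beta> :: real
  assumes "finite FF" and "finite TT" and "1 \<le> mmax"
    and "0 \<le> \<alpha>" and "0 \<le> \<beta>" and "\<alpha> + \<beta> \<le> 1"
  shows "\<exists>(N::nat) (\<psi> :: ('s, 't, 'm::finite) rgraph \<Rightarrow> nat \<Rightarrow> real) (\<phi> :: ('s, 't) lgraph \<Rightarrow> nat \<Rightarrow> real).
     (\<forall>z\<in>relaxed_graphs FF TT. \<forall>i\<ge>N. \<psi> z i = 0) \<and>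
     (\<forall>y\<in>graphs FF TT mmax. \<forall>i\<ge>N. \<phi> y i = 0) \<and>
     (\<forall>i<N. (\<lambda>z. \<psi> z i) \<in> borel_measurable (restrict_space borel (relaxed_graphs FF TT))) \<and>
     (\<forall>i<N. (\<lambda>y. \<phi> y i) \<in> borel_measurable (count_space (graphs FF TT mmax))) \<and>
     (\<exists>B. \<forall>z\<in>relaxed_graphs FF TT. sqrt (\<Sum>i<N. (\<psi> z i)\<^sup>2) \<le> B) \<and>
     (\<forall>y\<in>graphs FF TT mmax. sqrt (\<Sum>i<N. (\<phi> y i)\<^sup>2) \<le> 1) \<and>
     (\<forall>z\<in>relaxed_graphs FF TT. \<forall>y\<in>graphs FF TT mmax.
        FNGW \<alpha> \<beta> z y = (\<Sum>i<N. \<psi> z i * \<phi> y i))"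
proof -
  let ?Z = "relaxed_graphs FF TT :: ('s, 't, 'm) rgraph set" and ?G = "graphs FF TT mmax"
  obtain K where K: "\<And>z y. z \<in> ?Z \<Longrightarrow> y \<in> ?G \<Longrightarrow> \<bar>FNGW \<alpha> \<beta> z y\<bar> \<le> K"
    using FNGW_bounded[OF assms(1,2,4-6)] by blast
  have measurable: "(\<lambda>z. FNGW \<alpha> \<beta> z y) \<in> borel_measurable (restrict_space borel ?Z)" if "y \<in> ?G" for y
    using graphs_nodes_ge_1[OF that] assms(4-6)
    by (intro measurable_restrict_space1 borel_measurable_FNGW)
  obtain N and \<psi> :: "('s, 't, 'm) rgraph \<Rightarrow> nat \<Rightarrow> real" and \<phi> where embedding:
    "\<And>z i. N \<le> i \<Longrightarrow> \<psi> z i = 0" "\<And>y i. N \<le> i \<Longrightarrow> \<phi> y i = 0"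
    "\<And>i. i < N \<Longrightarrow> (\<lambda>z. \<psi> z i) \<in> borel_measurable (restrict_space borel ?Z)"
    "\<And>z. z \<in> ?Z \<Longrightarrow> (\<Sum>i<N. (\<psi> z i)\<^sup>2) \<le> real N * K\<^sup>2"
    "\<And>y. y \<in> ?G \<Longrightarrow> (\<Sum>i<N. (\<phi> y i)\<^sup>2) = 1"
    "\<And>z y. y \<in> ?G \<Longrightarrow> FNGW \<alpha> \<beta> z y = (\<Sum>i<N. \<psi> z i * \<phi> y i)"
    using finite_loss_embedding[where Y = ?G and Z = ?Z and L = "FNGW \<alpha> \<beta>",
        OF finite_graphs[OF assms(1,2)] measurable K]
    by blast
  show ?thesis
    by (intro exI[of _ N] exI[of _ \<psi>] exI[of _ \<phi>] exI[of _ "sqrt (real N * K\<^sup>2)"] conjI ballI allI impI)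
      (simp_all add: embedding)
qed

end
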